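(* Let $\mathcal{H}$ be a nonzero real Hilbert space, and let $K_1$ and $K_2$ be nonempty closed convex cones in $\mathcal{H}$ such that $K_1\neq\{0\}$ and $K_2\neq\{0\}$. Then the following statements are equivalent: (i) $c_0(K_1,K_2)<1$. (ii) $\sup\{\langle P_{K_1}x,\ P_{K_2}P_{K_1}x\rangle : x\in\mathbf{S}_{\mathcal{H}}\}<1$. (iii) $d(K_1\cap\mathbf{S}_{\mathcal{H}},\ K_2\cap\mathbf{S}_{\mathcal{H}})>0$. (iv) $\inf\left\{\frac{\|x-y\|}{\|x\|+\|y\|} : x\in K_1,\ y\in K_2,\ (x,y)\neq(0,0)\right\}>0$.
   Context: $\mathbf{B}_{\mathcal{H}}=\{x\in\mathcal{H}:\|x\|\le 1\}$ and $\mathbf{S}_{\mathcal{H}}=\{x\in\mathcal{H}:\|x\|=1\}$. A set $K\subseteq\mathcal{H}$ is a cone if $K=\mathbb{R}_{++}K$, where $\mathbb{R}_{++}=\{\lambda\in\mathbb{R}:\lambda>0\}$ (so a nonempty closed cone contains $0$). For a nonempty closed convex set $A$, $P_A$ is the projector (nearest-point map) onto $A$. $d(A,B):=\inf\{\|x-y\| : x\in A,\ y\in B\}$. For nonempty closed convex cones $K_1,K_2$, the cosine of the minimal angle between them is $$c_0(K_1,K_2):=\sup\{\langle x,y\rangle : x\in K_1\cap\mathbf{B}_{\mathcal{H}},\ y\in K_2\cap\mathbf{B}_{\mathcal{H}}\}.$$ *)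

theory Defs
  imports "HOL-Analysis.Analysis"
begin

(* Real Hilbert spaces are types of sort {real_inner, complete_space}. *)

(* The library predicates cone and conic quantify over all scalars c >= 0, so they force a
   nonempty set to contain 0; here only invariance under strictly positive scaling is required. *)
definition pos_cone :: "'a::real_vector set \<Rightarrow> bool"
  where "pos_cone K \<longleftrightarrow> K = {c *\<^sub>R x | c x. c > 0 \<and> x \<in> K}"

(* Same notion as the library's closest_point, whose sort heine_borel would exclude
   infinite-dimensional spaces. Meaningful when the nearest point exists and is unique, in
   particular for nonempty closed convex sets in a Hilbert space. *)
definition projector :: "'a::real_inner set \<Rightarrow> 'a \<Rightarrow> 'a"
  where "projector A x = (THE p. p \<in> A \<and> (\<forall>y\<in>A. norm (x - p) \<le> norm (x - y)))"

definition cos_min_angle :: "'a::real_inner set \<Rightarrow> 'a set \<Rightarrow> real"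
  where "cos_min_angle K1 K2 =
    Sup {inner x y | x y. x \<in> K1 \<inter> cball 0 1 \<and> y \<in> K2 \<inter> cball 0 1}"

end

theory Submission
  imports Defs
begin

text \<open>
  Every one of the four quantities is compared with the bound
  \<open>inner x y \<le> c\<close>, \<open>c < 1\<close>, over unit vectors \<open>x \<in> K1\<close>, \<open>y \<in> K2\<close>.
  For (iii) use the identity \<open>\<parallel>x - y\<parallel>\<^sup>2 = 2 - 2 inner x y\<close>, for (iv) the identity
  \<open>a\<^sup>2 + b\<^sup>2 - 2 c a b = (1 - c)/2 (a + b)\<^sup>2 + (1 + c)/2 (a - b)\<^sup>2\<close>.
  For (ii), the projection \<open>q\<close> of a unit vector \<open>x \<in> K1\<close> onto the cone \<open>K2\<close> satisfies
  \<open>inner x q = \<parallel>q\<parallel>\<^sup>2\<close> and \<open>inner x y \<le> inner q y \<le> \<parallel>q\<parallel>\<close> for unit \<open>y \<in> K2\<close>, so a bound \<open>s\<close> on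
  \<open>inner x q\<close> yields the bound \<open>sqrt s\<close> on \<open>inner x y\<close>.
\<close>

section \<open>Nearest points in closed convex sets\<close>

text \<open>The sets \<open>S n\<close> of points of \<open>A\<close> within \<open>r n\<close> of
  \<open>x\<close> are closed, nonempty and decreasing. The parallelogram law makes their diameters
  shrink to 0, so completeness yields a common point, whose distance to \<open>x\<close> is at most
  \<open>d\<close>.\<close>

lemma exists_nearest_point:
  fixes A :: "'a::{real_inner, complete_space} set"
  assumes "convex A" "closed A" "A \<noteq> {}"
  shows "\<exists>p\<in>A. \<forall>y\<in>A. dist x p \<le> dist x y"
proof -
  define d where "d = infdist x A"
  define r where "r n = d + inverse (real (Suc n))" for n
  define S where "S n = A \<inter> cball x (r n)" for n
  have d0: "d \<ge> 0"
    by (simp add: d_def infdist_nonneg)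
  have r_lim: "r \<longlonglongrightarrow> d"
    unfolding r_def using tendsto_add[OF tendsto_const LIMSEQ_inverse_real_of_nat, of d] by simp
  have close: "(dist y z)\<^sup>2 \<le> 4 * ((r n)\<^sup>2 - d\<^sup>2)" if y: "y \<in> S n" and z: "z \<in> S n" for y z n
  proof -
    \<comment> \<open>The midpoint stays in \<open>A\<close> by convexity, hence at distance at
      least \<open>d\<close> from \<open>x\<close>.\<close>
    define m where "m = (1/2) *\<^sub>R y + (1/2) *\<^sub>R z"
    have "m \<in> A"
      using convexD[OF assms(1), of y z "1/2" "1/2"] y z by (auto simp: m_def S_def)
    then have "d\<^sup>2 \<le> (dist x m)\<^sup>2"
      using d0 by (simp add: d_def infdist_le)
    moreover have "(dist x y)\<^sup>2 \<le> (r n)\<^sup>2" "(dist x z)\<^sup>2 \<le> (r n)\<^sup>2"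
      using y z by (auto simp: S_def intro: power_mono)
    \<comment> \<open>Parallelogram law for \<open>x - y\<close> and \<open>x - z\<close>, whose sum
      is twice \<open>x - m\<close>.\<close>
    moreover have "(dist y z)\<^sup>2 = 2 * (dist x y)\<^sup>2 + 2 * (dist x z)\<^sup>2 - 4 * (dist x m)\<^sup>2"
      unfolding dist_norm power2_norm_eq_inner m_def
      by (simp add: inner_diff inner_add inner_commute field_simps)
    ultimately show ?thesis unfolding right_diff_distrib by simp
  qed
  obtain p where p: "\<And>n. p \<in> S n"
  proof (rule decreasing_closed_nest)
    show "closed (S n)" for n
      using assms(2) by (simp add: S_def closed_Int)
    show "S n \<noteq> {}" for n
    proof -
      have "Inf (dist x ` A) < r n"
        using assms(3) by (simp add: r_def d_def infdist_notempty)
      then obtain a where "a \<in> A" "dist x a < r n"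
        using cInf_lessD[of "dist x ` A" "r n"] assms(3) by auto
      then show ?thesis
        by (auto simp: S_def)
    qed
    show "S n \<subseteq> S m" if "m \<le> n" for m n
    proof -
      have "r n \<le> r m"
        using that by (simp add: r_def field_simps)
      then show ?thesis
        by (auto simp: S_def)
    qed
    show "\<exists>n. \<forall>y\<in>S n. \<forall>z\<in>S n. dist y z < e" if "e > 0" for e
    proof -
      have "(\<lambda>n. 4 * ((r n)\<^sup>2 - d\<^sup>2)) \<longlonglongrightarrow> 4 * (d\<^sup>2 - d\<^sup>2)"
        by (intro tendsto_intros r_lim)
      then have "\<forall>\<^sub>F n in sequentially. 4 * ((r n)\<^sup>2 - d\<^sup>2) < e\<^sup>2"
        using that by (auto elim: order_tendstoD)
      then obtain n where "4 * ((r n)\<^sup>2 - d\<^sup>2) < e\<^sup>2"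
        using eventually_happens'[OF sequentially_bot] by blast
      with close[of _ n] that have "\<forall>y\<in>S n. \<forall>z\<in>S n. dist y z < e"
        by (meson le_less_trans less_eq_real_def power_less_imp_less_base)
      then show ?thesis ..
    qed
  qed blast
  have "dist x p \<le> d"
    using p by (intro LIMSEQ_le_const[OF r_lim]) (auto simp: S_def)
  then have "\<forall>y\<in>A. dist x p \<le> dist x y"
    by (auto simp: d_def intro: order_trans infdist_le)
  then show ?thesis
    using p[of 0] by (auto simp: S_def)
qed

text \<open>Existence and uniqueness of the nearest point make the definite description in
  \<open>projector\<close> meaningful.\<close>

lemma projector_nearest:
  fixes A :: "'a::{real_inner, complete_space} set"
  assumes "convex A" "closed A" "A \<noteq> {}"
  shows "projector A x \<in> A \<and> (\<forall>y\<in>A. norm (x - projector A x) \<le> norm (x - y))"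
  unfolding projector_def
proof (rule theI')
  show "\<exists>!p. p \<in> A \<and> (\<forall>y\<in>A. norm (x - p) \<le> norm (x - y))"
    using exists_nearest_point[OF assms, of x] any_closest_point_unique[OF assms(1,2), of _ _ x]
    unfolding dist_norm by blast
qed

lemma projector_self:
  fixes A :: "'a::{real_inner, complete_space} set"
  assumes "convex A" "closed A" "x \<in> A"
  shows "projector A x = x"
  using projector_nearest[OF assms(1,2), of x] assms(3) by fastforce

section \<open>Positive cones and projections onto them\<close>

lemma pos_cone_scaleR:
  assumes "pos_cone K" "x \<in> K" "c > 0"
  shows "c *\<^sub>R x \<in> K"
  using assms unfolding pos_cone_def by blast

text \<open>Positive multiples of a point of \<open>K\<close> with factors tending to 0 stay in
  \<open>K\<close>, and closedness keeps their limit.\<close>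

lemma closed_pos_cone_zero:
  fixes K :: "'a::real_normed_vector set"
  assumes "pos_cone K" "closed K" "K \<noteq> {}"
  shows "0 \<in> K"
proof -
  obtain x where "x \<in> K" using assms(3) by blast
  then have "inverse (real (Suc n)) *\<^sub>R x \<in> K" for n
    by (intro pos_cone_scaleR[OF assms(1)]) simp_all
  moreover have "(\<lambda>n. inverse (real (Suc n)) *\<^sub>R x) \<longlonglongrightarrow> 0"
    using tendsto_scaleR[OF LIMSEQ_inverse_real_of_nat tendsto_const, of x] by simp
  ultimately show ?thesis
    by (rule closed_sequentially[OF assms(2)])
qed

lemma pos_cone_sgn:
  fixes K :: "'a::real_normed_vector set"
  assumes "pos_cone K" "x \<in> K" "x \<noteq> 0"
  shows "sgn x \<in> K \<inter> sphere 0 1"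
  using pos_cone_scaleR[OF assms(1,2), of "inverse (norm x)"] assms(3)
  by (simp add: sgn_div_norm norm_sgn)

lemma pos_cone_sphere_nonempty:
  fixes K :: "'a::real_normed_vector set"
  assumes "pos_cone K" "K \<noteq> {}" "K \<noteq> {0}"
  shows "K \<inter> sphere 0 1 \<noteq> {}"
  using pos_cone_sgn[OF assms(1)] assms(2,3) by blast

text \<open>All three follow from the variational inequality at the nearest point \<open>q\<close>:
  on a cone it makes \<open>x - q\<close> orthogonal to \<open>q\<close>, with nonpositive inner
  product against every point of \<open>K\<close>.\<close>

lemma projector_cone:
  fixes K :: "'a::{real_inner, complete_space} set"
  assumes "pos_cone K" "convex K" "closed K" "K \<noteq> {}"
  shows inner_projector_self: "inner x (projector K x) = (norm (projector K x))\<^sup>2"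
    and inner_le_inner_projector: "y \<in> K \<Longrightarrow> inner x y \<le> inner (projector K x) y"
    and norm_projector_le: "norm (projector K x) \<le> norm x"
proof -
  define q where "q = projector K x"
  have q: "q \<in> K" "\<forall>y\<in>K. dist x q \<le> dist x y"
    using projector_nearest[OF assms(2-4), of x] by (simp_all add: q_def dist_norm)
  have dot: "inner (x - q) (y - q) \<le> 0" if "y \<in> K" for y
    using any_closest_point_dot[OF assms(2,3) q(1) that q(2)] .
  \<comment> \<open>The test points 0 and \<open>2 q\<close> bound the inner product from opposite
    sides.\<close>
  have orth: "inner (x - q) q = 0"
    using dot[OF closed_pos_cone_zero[OF assms(1,3,4)]]
      dot[OF pos_cone_scaleR[OF assms(1) q(1), of 2]]
    by (simp add: scaleR_2)
  show self: "inner x (projector K x) = (norm (projector K x))\<^sup>2"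
    using orth by (simp add: q_def inner_diff power2_norm_eq_inner)
  show "inner x y \<le> inner (projector K x) y" if "y \<in> K"
    using dot[OF that] orth by (simp add: q_def inner_diff)
  have "norm q * norm q \<le> norm x * norm q"
    using self norm_cauchy_schwarz[of x q] by (simp add: q_def power2_eq_square)
  then show "norm (projector K x) \<le> norm x"
    by (cases "q = 0") (auto simp: q_def)
qed

section \<open>The common angle bound\<close>

text \<open>The pivot for all four conditions. Asking for some bound \<open>c < 1\<close> instead of
  using a supremum avoids questions of boundedness and nonemptiness.\<close>

definition angle_bounded :: "'a::real_inner set \<Rightarrow> 'a set \<Rightarrow> bool"
  where "angle_bounded K1 K2 \<longleftrightarrow>
    (\<exists>c<1. \<forall>x\<in>K1 \<inter> sphere 0 1. \<forall>y\<in>K2 \<inter> sphere 0 1. inner x y \<le> c)"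

text \<open>Homogeneity carries the bound from unit vectors to the whole cones, via
  \<open>sgn\<close>.\<close>

lemma angle_boundedE:
  assumes "angle_bounded K1 K2" "pos_cone K1" "pos_cone K2"
  obtains c where "0 \<le> c" "c < 1"
    "\<And>x y. x \<in> K1 \<Longrightarrow> y \<in> K2 \<Longrightarrow> inner x y \<le> c * (norm x * norm y)"
proof -
  obtain c where c: "c < 1" "\<And>x y. x \<in> K1 \<inter> sphere 0 1 \<Longrightarrow> y \<in> K2 \<inter> sphere 0 1 \<Longrightarrow> inner x y \<le> c"
    using assms(1) unfolding angle_bounded_def by blast
  show ?thesis
  proof
    \<comment> \<open>Raising a negative \<open>c\<close> to 0 ensures that
      \<open>c * (norm x * norm y)\<close> is at most \<open>c\<close> on the unit balls.\<close>
    show "0 \<le> max c 0" "max c 0 < 1"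
      using c(1) by auto
    show "inner x y \<le> max c 0 * (norm x * norm y)" if "x \<in> K1" "y \<in> K2" for x y
    proof (cases "x = 0 \<or> y = 0")
      case False
      then have "inner (sgn x) (sgn y) \<le> max c 0"
        using c(2)[of "sgn x" "sgn y"] pos_cone_sgn assms(2,3) that by fastforce
      with False show ?thesis
        by (simp add: sgn_div_norm field_simps)
    qed auto
  qed
qed

section \<open>Condition (i): the minimal angle\<close>

lemma cos_min_angle_less_1_iff:
  fixes K1 K2 :: "'a::real_inner set"
  assumes "pos_cone K1" "pos_cone K2" "0 \<in> K1" "0 \<in> K2"
  shows "cos_min_angle K1 K2 < 1 \<longleftrightarrow> angle_bounded K1 K2"
proof
  let ?X = "{inner x y | x y. x \<in> K1 \<inter> cball 0 1 \<and> y \<in> K2 \<inter> cball 0 1}"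
  have le1: "norm x * norm y \<le> 1" if "norm x \<le> 1" "norm y \<le> 1" for x y :: 'a
    using that by (simp add: mult_le_one)
  \<comment> \<open>Cauchy-Schwarz bounds the set, so its \<open>Sup\<close> is a genuine
    supremum.\<close>
  have "bdd_above ?X"
    using le1 by (auto intro!: bdd_aboveI[where M=1] intro: order_trans[OF norm_cauchy_schwarz])
  then have "inner x y \<le> cos_min_angle K1 K2" if "x \<in> K1 \<inter> sphere 0 1" "y \<in> K2 \<inter> sphere 0 1" for x y
    unfolding cos_min_angle_def using that by (intro cSup_upper) fastforce+
  then show "angle_bounded K1 K2" if "cos_min_angle K1 K2 < 1"
    using that unfolding angle_bounded_def by blast
  assume "angle_bounded K1 K2"
  then obtain c where c: "0 \<le> c" "c < 1"
    "\<And>x y. x \<in> K1 \<Longrightarrow> y \<in> K2 \<Longrightarrow> inner x y \<le> c * (norm x * norm y)"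
    using angle_boundedE assms(1,2) by blast
  have "inner x y \<le> c" if "x \<in> K1 \<inter> cball 0 1" "y \<in> K2 \<inter> cball 0 1" for x y
    using c(3)[of x y] mult_left_mono[OF le1 c(1), of x y] that by auto
  moreover have "?X \<noteq> {}"
    using assms(3,4) by force
  ultimately have "cos_min_angle K1 K2 \<le> c"
    unfolding cos_min_angle_def by (intro cSup_least) auto
  with c(2) show "cos_min_angle K1 K2 < 1" by simp
qed

section \<open>Condition (ii): successive projections\<close>

lemma Sup_inner_projector_less_1_iff:
  fixes K1 K2 :: "'a::{real_inner, complete_space} set"
  assumes K1: "pos_cone K1" "convex K1" "closed K1" "K1 \<noteq> {}" "K1 \<noteq> {0}"
    and K2: "pos_cone K2" "convex K2" "closed K2" "K2 \<noteq> {}"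
  shows "Sup {inner (projector K1 x) (projector K2 (projector K1 x)) | x. x \<in> sphere 0 1} < 1
    \<longleftrightarrow> angle_bounded K1 K2" (is "Sup ?X < 1 \<longleftrightarrow> _")
proof
  have norms: "norm (projector K1 x) \<le> 1" "norm (projector K2 (projector K1 x)) \<le> 1"
    if "x \<in> sphere 0 1" for x
    using that norm_projector_le[OF K1(1-4), of x] norm_projector_le[OF K2, of "projector K1 x"] by auto
  have prod_norms: "norm (projector K1 x) * norm (projector K2 (projector K1 x)) \<le> 1"
    if "x \<in> sphere 0 1" for x
    using norms[OF that] by (simp add: mult_le_one)
  have bdd: "bdd_above ?X"
    using prod_norms
    by (intro bdd_aboveI[where M=1]) (auto intro: order_trans[OF norm_cauchy_schwarz])
  have ne: "?X \<noteq> {}"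
    using pos_cone_sphere_nonempty[OF K1(1,4,5)] by blast
  {
    assume less: "Sup ?X < 1"
    show "angle_bounded K1 K2"
      unfolding angle_bounded_def
    proof (intro exI conjI ballI)
      show "sqrt (Sup ?X) < 1"
        using less by simp
      fix x y assume x: "x \<in> K1 \<inter> sphere 0 1" and y: "y \<in> K2 \<inter> sphere 0 1"
      define q where "q = projector K2 x"
      have self: "projector K1 x = x"
        using projector_self[OF K1(2,3)] x by simp
      \<comment> \<open>As \<open>x\<close> is a unit vector fixed by \<open>projector K1\<close>,
        it serves as its own index in the supremum.\<close>
      have "inner x q \<in> ?X"
        using self x unfolding q_def by force
      then have "(norm q)\<^sup>2 \<le> Sup ?X"
        using cSup_upper[OF _ bdd] inner_projector_self[OF K2, of x] by (simp add: q_def)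
      then have "norm q \<le> sqrt (Sup ?X)"
        by (rule real_le_rsqrt)
      moreover have "inner x y \<le> inner q y"
        using inner_le_inner_projector[OF K2] y by (simp add: q_def)
      moreover have "inner q y \<le> norm q"
        using norm_cauchy_schwarz[of q y] y by simp
      ultimately show "inner x y \<le> sqrt (Sup ?X)" by linarith
    qed
  }
  assume "angle_bounded K1 K2"
  then obtain c where c: "0 \<le> c" "c < 1"
    "\<And>x y. x \<in> K1 \<Longrightarrow> y \<in> K2 \<Longrightarrow> inner x y \<le> c * (norm x * norm y)"
    using angle_boundedE K1(1) K2(1) by blast
  have "inner (projector K1 x) (projector K2 (projector K1 x)) \<le> c" if "x \<in> sphere 0 1" for x
  proof -
    have "projector K1 x \<in> K1" "projector K2 (projector K1 x) \<in> K2"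
      using projector_nearest K1(2-4) K2(2-4) by blast+
    from c(3)[OF this] show ?thesis
      using mult_left_mono[OF prod_norms[OF that] c(1)] by simp
  qed
  then have "Sup ?X \<le> c"
    using ne by (intro cSup_least) auto
  with c(2) show "Sup ?X < 1" by simp
qed

section \<open>Condition (iii): distance between the spherical parts\<close>

lemma dist_unit_vectors:
  fixes x y :: "'a::real_inner"
  assumes "norm x = 1" "norm y = 1"
  shows "(dist x y)\<^sup>2 = 2 - 2 * inner x y"
  using assms unfolding dist_norm power2_norm_eq_inner norm_eq_1
  by (simp add: inner_diff inner_commute)

text \<open>Serves both (iii) and (iv). The constant is \<open>dist_unit_vectors\<close> solved for
  the inner product at distance \<delta>.\<close>

lemma angle_bounded_of_dist_ge:
  fixes K1 K2 :: "'a::real_inner set"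
  assumes "\<delta> > 0" "\<And>x y. x \<in> K1 \<inter> sphere 0 1 \<Longrightarrow> y \<in> K2 \<inter> sphere 0 1 \<Longrightarrow> \<delta> \<le> dist x y"
  shows "angle_bounded K1 K2"
  unfolding angle_bounded_def
proof (intro exI conjI ballI)
  show "1 - \<delta>\<^sup>2 / 2 < 1"
    using assms(1) by simp
  fix x y assume xy: "x \<in> K1 \<inter> sphere 0 1" "y \<in> K2 \<inter> sphere 0 1"
  then have "\<delta>\<^sup>2 \<le> (dist x y)\<^sup>2"
    using assms(1) assms(2)[OF xy] by (intro power_mono) auto
  then show "inner x y \<le> 1 - \<delta>\<^sup>2 / 2"
    using xy dist_unit_vectors[of x y] by simp
qed

lemma setdist_spheres_pos_iff:
  fixes K1 K2 :: "'a::real_inner set"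
  assumes ne: "K1 \<inter> sphere 0 1 \<noteq> {}" "K2 \<inter> sphere 0 1 \<noteq> {}"
  shows "setdist (K1 \<inter> sphere 0 1) (K2 \<inter> sphere 0 1) > 0 \<longleftrightarrow> angle_bounded K1 K2"
proof
  show "angle_bounded K1 K2" if "setdist (K1 \<inter> sphere 0 1) (K2 \<inter> sphere 0 1) > 0"
    using that setdist_le_dist by (rule angle_bounded_of_dist_ge)
  assume "angle_bounded K1 K2"
  then obtain c where c: "c < 1"
    "\<And>x y. x \<in> K1 \<inter> sphere 0 1 \<Longrightarrow> y \<in> K2 \<inter> sphere 0 1 \<Longrightarrow> inner x y \<le> c"
    unfolding angle_bounded_def by blast
  have "sqrt (2 - 2 * c) \<le> dist x y" if "x \<in> K1 \<inter> sphere 0 1" "y \<in> K2 \<inter> sphere 0 1" for x y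
    using c(2)[OF that] dist_unit_vectors[of x y] that by (intro real_le_lsqrt) auto
  \<comment> \<open>Nonemptiness matters here: \<open>setdist\<close> is 0 by convention if a set is
    empty.\<close>
  then have "sqrt (2 - 2 * c) \<le> setdist (K1 \<inter> sphere 0 1) (K2 \<inter> sphere 0 1)"
    using ne by (intro le_setdistI)
  moreover have "sqrt (2 - 2 * c) > 0"
    using c(1) by simp
  ultimately show "setdist (K1 \<inter> sphere 0 1) (K2 \<inter> sphere 0 1) > 0" by linarith
qed

section \<open>Condition (iv): the normalized distance\<close>

text \<open>The lower bound for the squared distance splits into squares of
  \<open>norm x + norm y\<close> and \<open>norm x - norm y\<close>, with nonnegative weights for
  these \<open>c\<close>; the second square is dropped.\<close>

lemma norm_diff_ge_of_inner_le:
  fixes x y :: "'a::real_inner"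
  assumes "inner x y \<le> c * (norm x * norm y)" "-1 \<le> c" "c \<le> 1"
  shows "sqrt ((1 - c) / 2) * (norm x + norm y) \<le> norm (x - y)"
proof (rule power2_le_imp_le)
  have "(sqrt ((1 - c) / 2) * (norm x + norm y))\<^sup>2 = (1 - c) / 2 * (norm x + norm y)\<^sup>2"
    using assms(3) by (simp add: power_mult_distrib)
  also have "\<dots> \<le> (1 - c) / 2 * (norm x + norm y)\<^sup>2 + (1 + c) / 2 * (norm x - norm y)\<^sup>2"
    using assms(2) by simp
  also have "\<dots> = (norm x)\<^sup>2 + (norm y)\<^sup>2 - 2 * (c * (norm x * norm y))"
    by (simp add: power2_eq_square field_simps)
  also have "\<dots> \<le> (norm x)\<^sup>2 + (norm y)\<^sup>2 - 2 * inner x y"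
    using assms(1) by simp
  also have "\<dots> = (norm (x - y))\<^sup>2"
    by (simp add: power2_norm_eq_inner inner_diff inner_commute)
  finally show "(sqrt ((1 - c) / 2) * (norm x + norm y))\<^sup>2 \<le> (norm (x - y))\<^sup>2" .
qed simp

lemma Inf_norm_quotient_pos_iff:
  fixes K1 K2 :: "'a::real_inner set"
  assumes "pos_cone K1" "pos_cone K2" "K1 \<noteq> {}" "K1 \<noteq> {0}" "K2 \<noteq> {}"
  shows "Inf {norm (x - y) / (norm x + norm y) | x y. x \<in> K1 \<and> y \<in> K2 \<and> (x, y) \<noteq> (0, 0)} > 0
    \<longleftrightarrow> angle_bounded K1 K2" (is "Inf ?X > 0 \<longleftrightarrow> _")
proof
  {
    assume pos: "Inf ?X > 0"
    have bdd: "bdd_below ?X"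
      by (intro bdd_belowI[where m=0]) auto
    show "angle_bounded K1 K2"
    proof (rule angle_bounded_of_dist_ge)
      \<comment> \<open>For unit vectors the denominator is 2, whence the factor.\<close>
      show "2 * Inf ?X > 0"
        using pos by simp
      fix x y assume xy: "x \<in> K1 \<inter> sphere 0 1" "y \<in> K2 \<inter> sphere 0 1"
      then have "Inf ?X \<le> norm (x - y) / (norm x + norm y)"
        by (intro cInf_lower bdd) fastforce
      with xy show "2 * Inf ?X \<le> dist x y"
        by (simp add: dist_norm)
    qed
  }
  assume "angle_bounded K1 K2"
  then obtain c where c: "0 \<le> c" "c < 1"
    "\<And>x y. x \<in> K1 \<Longrightarrow> y \<in> K2 \<Longrightarrow> inner x y \<le> c * (norm x * norm y)"
    using angle_boundedE assms(1,2) by blast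
  have "sqrt ((1 - c) / 2) \<le> norm (x - y) / (norm x + norm y)"
    if "x \<in> K1" "y \<in> K2" "(x, y) \<noteq> (0, 0)" for x y
  proof -
    have "norm x + norm y > 0"
      using that(3) by (auto intro: add_pos_nonneg add_nonneg_pos)
    then show ?thesis
      using norm_diff_ge_of_inner_le[OF c(3)[OF that(1,2)]] c(1,2) by (simp add: pos_le_divide_eq)
  qed
  moreover have "?X \<noteq> {}"
  proof -
    \<comment> \<open>A nonzero \<open>x\<close> keeps the pair away from \<open>(0, 0)\<close>,
      whatever \<open>y\<close> is.\<close>
    obtain x y where "x \<in> K1" "x \<noteq> 0" "y \<in> K2"
      using assms(3-5) by blast
    then show ?thesis by blast
  qed
  ultimately have "sqrt ((1 - c) / 2) \<le> Inf ?X"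
    by (intro cInf_greatest) auto
  moreover have "sqrt ((1 - c) / 2) > 0"
    using c(2) by simp
  ultimately show "Inf ?X > 0" by linarith
qed

theorem theorem4p6:
  fixes K1 K2 :: "'a::{real_inner, complete_space} set"
  assumes "(UNIV :: 'a set) \<noteq> {0}"
    and "K1 \<noteq> {}" and "closed K1" and "convex K1" and "pos_cone K1"
    and "K2 \<noteq> {}" and "closed K2" and "convex K2" and "pos_cone K2"
    and "K1 \<noteq> {0}" and "K2 \<noteq> {0}"
  defines "i \<equiv> cos_min_angle K1 K2 < 1"
    and "ii \<equiv> Sup {inner (projector K1 x) (projector K2 (projector K1 x)) | x. x \<in> sphere 0 1} < 1"
    and "iii \<equiv> setdist (K1 \<inter> sphere 0 1) (K2 \<inter> sphere 0 1) > 0"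
    and "iv \<equiv> Inf {norm (x - y) / (norm x + norm y) | x y. x \<in> K1 \<and> y \<in> K2 \<and> (x, y) \<noteq> (0, 0)} > 0"
  shows "(i \<longleftrightarrow> ii) \<and> (ii \<longleftrightarrow> iii) \<and> (iii \<longleftrightarrow> iv)"
proof -
  have zero: "0 \<in> K1" "0 \<in> K2"
    using assms(2-9) closed_pos_cone_zero by blast+
  have "K1 \<inter> sphere 0 1 \<noteq> {}" "K2 \<inter> sphere 0 1 \<noteq> {}"
    using assms(2-11) pos_cone_sphere_nonempty by blast+
  then show ?thesis
    unfolding i_def ii_def iii_def iv_def
    using cos_min_angle_less_1_iff[OF assms(5,9) zero]
      Sup_inner_projector_less_1_iff[OF assms(5,4,3,2,10,9,8,7,6)]
      setdist_spheres_pos_iff[of K1 K2]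
      Inf_norm_quotient_pos_iff[OF assms(5,9,2,10,6)]
    by blast
qed

end
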